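(* Let $n$ be a $2$-near perfect number with omitted divisors $d_1$ and $d_2$, and assume $n = 2^k p^2$ where $p$ is prime and $k$ is a nonnegative integer. Then $n \in \{18, 36, 200\}$.
   Context: $\sigma(n)$ denotes the sum of the positive divisors of $n$. A positive integer $n$ is called $2$-near perfect if $\sigma(n) = 2n + d_1 + d_2$ for some two distinct positive divisors $d_1, d_2$ of $n$; these $d_1, d_2$ are called the omitted divisors. *)

theory Defs
  imports "HOL-Computational_Algebra.Primes"
begin

(* Intended for n > 0; at n = 0 the index set is infinite and the sum is 0. *)
definition divisor_sigma :: "nat \<Rightarrow> nat" where
  "divisor_sigma n = (\<Sum>d | d dvd n. d)"

(* "Divisor" is not restricted to proper divisors: d1 or d2 may be n itself.
   Positivity of d1 and d2 follows from n > 0. *)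
definition omitted_divisors :: "nat \<Rightarrow> nat \<Rightarrow> nat \<Rightarrow> bool" where
  "omitted_divisors n d1 d2 \<longleftrightarrow>
     n > 0 \<and> d1 dvd n \<and> d2 dvd n \<and> d1 \<noteq> d2 \<and> divisor_sigma n = 2 * n + d1 + d2"

definition two_near_perfect :: "nat \<Rightarrow> bool" where
  "two_near_perfect n \<longleftrightarrow> (\<exists>d1 d2. omitted_divisors n d1 d2)"

end

theory Submission
  imports Defs
begin

text \<open>
  For odd \<open>p\<close> and \<open>M = 2 ^ (k + 1)\<close> the defining equation reads
  \<open>d1 + d2 = M (p + 1) - (p\<^sup>2 + p + 1)\<close>. The right-hand side is odd, so one omitted divisor is
  \<open>p ^ c\<close> and the other one is \<open>x p ^ b\<close> with \<open>2 x\<close> dividing \<open>M\<close> and \<open>b, c \<le> 2\<close>. For \<open>b \<le> 1\<close>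
  the bound \<open>2 x \<le> M\<close> confines \<open>M\<close> to a short interval, in which at most one value has the right
  residue modulo \<open>p\<close>. For \<open>b = 2\<close> the equation modulo \<open>p + 1\<close> determines \<open>x\<close> modulo \<open>p + 1\<close>, and
  the resulting equation in two positive cofactors has few solutions.
\<close>

section \<open>Multiplicativity and prime-power values of the divisor sum\<close>

text \<open>By coprimality each divisor of \<open>a * b\<close> splits uniquely as
  \<open>x * y\<close> with \<open>x dvd a\<close> and \<open>y dvd b\<close>, so the sum over
  divisors factors as a product of two sums.\<close>

lemma divisor_sigma_coprime_mult:
  assumes "coprime a b" "a > 0" "b > 0"
  shows "divisor_sigma (a * b) = divisor_sigma a * divisor_sigma b"
proof -
  let ?f = "\<lambda>(x, y). x * y :: nat"
  let ?D = "{d. d dvd a} \<times> {d. d dvd b}"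
  have inj: "inj_on ?f ?D"
  proof (rule inj_onI, clarsimp)
    fix x y x' y' :: nat
    assume d: "x dvd a" "y dvd b" "x' dvd a" "y' dvd b" and eq: "x * y = x' * y'"
    have "coprime x y'" "coprime x' y"
      using d \<open>coprime a b\<close> coprime_divisors by blast+
    then have "x dvd x'" "x' dvd x"
      using eq by (metis coprime_dvd_mult_left_iff dvd_triv_left)+
    then have "x = x'" by (rule dvd_antisym)
    moreover have "x > 0" using d \<open>a > 0\<close> by (auto intro: Nat.gr0I)
    ultimately show "x = x' \<and> y = y'" using eq by simp
  qed
  have img: "?f ` ?D = {d. d dvd a * b}"
  proof
    show "?f ` ?D \<subseteq> {d. d dvd a * b}" by (auto intro: mult_dvd_mono)
    show "{d. d dvd a * b} \<subseteq> ?f ` ?D"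
      by (auto dest!: division_decomp)
  qed
  have "divisor_sigma (a * b) = (\<Sum>(x, y)\<in>?D. x * y)"
    unfolding divisor_sigma_def img[symmetric]
    by (subst sum.reindex[OF inj]) (simp add: case_prod_unfold)
  then show ?thesis
    by (simp add: divisor_sigma_def sum_product sum.cartesian_product)
qed

lemma divisor_sigma_prime_power:
  assumes "prime p"
  shows "divisor_sigma (p ^ k) = (\<Sum>i\<le>k. p ^ i)"
proof -
  have "{d. d dvd p ^ k} = (\<lambda>i. p ^ i) ` {..k}"
    using divides_primepow_nat[OF assms] by auto
  moreover have "inj_on (\<lambda>i. p ^ i) {..k}"
    using prime_gt_1_nat[OF assms] by (auto intro: inj_onI)
  ultimately show ?thesis
    by (simp add: divisor_sigma_def sum.reindex)
qed

text \<open>The \<open>+ 1\<close> stands on the left to avoid truncated subtraction on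
  naturals.\<close>

lemma divisor_sigma_two_power: "divisor_sigma (2 ^ k) + 1 = 2 ^ (k + 1)"
proof -
  have "(\<Sum>i\<le>k. 2 ^ i) + 1 = (2 ^ (k + 1) :: nat)" by (induction k) auto
  then show ?thesis by (simp add: divisor_sigma_prime_power)
qed

section \<open>The integer equation for the omitted divisors \<open>p ^ c\<close> and
  \<open>x * p ^ b\<close>\<close>

text \<open>Write R for \<open>p ^ c + p ^ 2 + p + 1\<close>. Positivity of \<open>x\<close> gives
  \<open>M * (p + 1) > R\<close>, and \<open>2 * x \<le> M\<close> gives
  \<open>M * (2 * p + 1) \<le> 2 * R\<close>. Only \<open>M = p + 1\<close> for \<open>c = 0\<close>
  and \<open>M = 2 * p\<close> for \<open>c = 2\<close> remain; both force \<open>x = p - 1\<close>,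
  which must divide \<open>M / 2\<close> or \<open>M\<close>.\<close>

lemma omitted_equation_cofactor_one:
  fixes p M x :: int
  assumes p: "p \<ge> 3" and x: "2 * x dvd M" "x > 0"
    and eq: "M * (p + 1) = p ^ c + x + p ^ 2 + p + 1" and c: "c \<le> 2"
  shows "(p, M) \<in> {(3, 4), (3, 6)}"
proof -
  have Mpos: "M > 0" using eq p x(2) by (smt (verit) zero_le_power zero_less_mult_iff)
  then have le: "2 * x \<le> M" using x zdvd_imp_le by blast
  consider "c = 0" | "c = 1" | "c = 2" using c by linarith
  then show ?thesis
  proof cases
    case 1
    have "M > p"
    proof (rule ccontr)
      assume "\<not> M > p"
      then have "M * (p + 1) \<le> p * (p + 1)" using p by (intro mult_right_mono) auto
      then show False using eq x 1 by (simp add: algebra_simps power2_eq_square)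
    qed
    moreover have "M < p + 2"
    proof (rule ccontr)
      assume "\<not> M < p + 2"
      then have "(p + 2) * (2 * p + 1) \<le> M * (2 * p + 1)" using p by (intro mult_right_mono) auto
      then show False using eq le 1 p by (simp add: algebra_simps power2_eq_square)
    qed
    ultimately have M: "M = p + 1" by simp
    then have xp: "x = p - 1" using eq 1 by (simp add: algebra_simps power2_eq_square)
    have "x dvd M" using x(1) by (rule dvd_mult_right)
    then have "x dvd M - x" by simp
    then have "x dvd 2" using M xp by simp
    then have "x \<le> 2" by (simp add: zdvd_imp_le)
    then show ?thesis using xp p M by auto
  next
    case 2
    have "M > p + 1"
    proof (rule ccontr)
      assume "\<not> M > p + 1"
      then have "M * (p + 1) \<le> (p + 1) * (p + 1)" using p by (intro mult_right_mono) auto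
      then show False using eq x 2 by (simp add: algebra_simps power2_eq_square)
    qed
    then have "(p + 2) * (2 * p + 1) \<le> M * (2 * p + 1)" using p by (intro mult_right_mono) auto
    then show ?thesis using eq le 2 p by (simp add: algebra_simps power2_eq_square)
  next
    case 3
    have "M > 2 * p - 1"
    proof (rule ccontr)
      assume "\<not> M > 2 * p - 1"
      then have "M * (p + 1) \<le> (2 * p - 1) * (p + 1)" using p by (intro mult_right_mono) auto
      then show False using eq x 3 by (simp add: algebra_simps power2_eq_square)
    qed
    moreover have "M < 2 * p + 1"
    proof (rule ccontr)
      assume "\<not> M < 2 * p + 1"
      then have "(2 * p + 1) * (2 * p + 1) \<le> M * (2 * p + 1)" using p by (intro mult_right_mono) auto
      then show False using eq le 3 p by (simp add: algebra_simps power2_eq_square)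
    qed
    ultimately have M: "M = 2 * p" by simp
    then have xp: "x = p - 1" using eq 3 by (simp add: algebra_simps power2_eq_square)
    have "x dvd p" using x(1) M by simp
    then have "x dvd 1" using xp by (metis diff_diff_eq2 add_diff_cancel_left' dvd_diff dvd_refl)
    then show ?thesis using xp p by auto
  qed
qed

text \<open>Here \<open>2 * x \<le> M\<close> yields
  \<open>M * (p + 2) \<le> 2 * (p ^ c + p ^ 2 + p + 1)\<close>. Modulo \<open>p\<close> the equation
  says that \<open>M\<close> is congruent to \<open>p ^ c + 1\<close>, so the bounds on
  \<open>M\<close> become bounds on the quotient \<open>t\<close>; the parity of \<open>M\<close>
  does the rest.\<close>

lemma omitted_equation_cofactor_prime:
  fixes p M x :: int
  assumes p: "p \<ge> 3" "odd p" and x: "2 * x dvd M" "x > 0"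
    and eq: "M * (p + 1) = p ^ c + x * p + p ^ 2 + p + 1" and c: "c \<le> 2"
  shows "(p, M) = (5, 16)"
proof -
  have "even M" using x(1) by (rule dvd_mult_left)
  have Mpos: "M > 0" using eq p x(2) by (smt (verit) zero_le_power zero_less_mult_iff)
  then have "2 * x \<le> M" using x zdvd_imp_le by blast
  then have le: "2 * x * p \<le> M * p" using p by (intro mult_right_mono) auto
  consider "c = 0" | "c = 1" | "c = 2" using c by linarith
  then show ?thesis
  proof cases
    case 1
    define t where "t = x + p + 1 - M"
    have M: "M = p * t + 2" using eq 1 by (simp add: t_def algebra_simps power2_eq_square)
    have "M > p"
    proof (rule ccontr)
      assume "\<not> M > p"
      then have "M * (p + 1) \<le> p * (p + 1)" using p by (intro mult_right_mono) auto
      moreover have "x * p > 0" using x p by simp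
      ultimately show False using eq 1 by (simp add: algebra_simps power2_eq_square)
    qed
    then have "p * t > 0" using p M \<open>even M\<close> by presburger
    then have "t > 0" using p by (simp add: zero_less_mult_iff)
    have "M < 2 * p"
    proof (rule ccontr)
      assume "\<not> M < 2 * p"
      then have "(2 * p) * (p + 2) \<le> M * (p + 2)" using p by (intro mult_right_mono) auto
      then show False using eq le p unfolding 1 power2_eq_square
        by (simp only: algebra_simps power_0 power_one_right)
    qed
    then have "p * t < p * 2" using M by simp
    then have "t < 2" using p by simp
    then have "t = 1" using \<open>t > 0\<close> by simp
    \<comment> \<open>\<open>M = p + 2\<close> is odd, a contradiction.\<close>
    then show ?thesis using M p \<open>even M\<close> by simp
  next
    case 2
    define t where "t = x + p + 2 - M"
    have M: "M = p * t + 1" using eq 2 by (simp add: t_def algebra_simps power2_eq_square)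
    have "M > p + 1"
    proof (rule ccontr)
      assume "\<not> M > p + 1"
      then have "M * (p + 1) \<le> (p + 1) * (p + 1)" using p by (intro mult_right_mono) auto
      moreover have "x * p > 0" using x p by simp
      ultimately show False using eq 2 by (simp add: algebra_simps power2_eq_square)
    qed
    then have "p * 1 < p * t" using M by simp
    then have "t > 1" using p by simp
    have "M < 2 * p + 1"
    proof (rule ccontr)
      assume "\<not> M < 2 * p + 1"
      then have "(2 * p + 1) * (p + 2) \<le> M * (p + 2)" using p by (intro mult_right_mono) auto
      then show False using eq le p unfolding 2 power2_eq_square
        by (simp only: algebra_simps power_0 power_one_right)
    qed
    then have "p * t < p * 2" using M by simp
    then have "t < 2" using p by simp
    then show ?thesis using \<open>t > 1\<close> by simp
  next
    case 3
    define t where "t = x + 2 * p + 1 - M"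
    have M: "M = p * t + 1" using eq 3 by (simp add: t_def algebra_simps power2_eq_square)
    have "M > 2 * p - 1"
    proof (rule ccontr)
      assume "\<not> M > 2 * p - 1"
      then have "M * (p + 1) \<le> (2 * p - 1) * (p + 1)" using p by (intro mult_right_mono) auto
      moreover have "x * p > 0" using x p by simp
      ultimately show False using eq p 3 by (simp add: algebra_simps power2_eq_square)
    qed
    then have "p * t > p * 1" using M p by linarith
    then have "t > 1" using p by simp
    have "M < 4 * p"
    proof (rule ccontr)
      assume "\<not> M < 4 * p"
      then have "(4 * p) * (p + 2) \<le> M * (p + 2)" using p by (intro mult_right_mono) auto
      then show False using eq le p unfolding 3 power2_eq_square
        by (simp only: algebra_simps power_0 power_one_right)
    qed
    then have "p * t < p * 4" using M by simp
    then have "t < 4" using p by simp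
    moreover have "odd t" using M \<open>even M\<close> by auto
    ultimately have t: "t = 3" using \<open>t > 1\<close> by presburger
    have "M = 3 * p + 1" using M t by simp
    \<comment> \<open>Eliminating \<open>p\<close> turns \<open>x dvd M\<close> into
      \<open>x dvd 8\<close>.\<close>
    then have xp: "x = p + 3" and M3: "M = 3 * x - 8" using t t_def by linarith+
    have "x dvd M" using x(1) by (rule dvd_mult_right)
    then have "x dvd 3 * x - M" by simp
    then have "x dvd 8" using M3 by simp
    then have "x \<le> 8" by (simp add: zdvd_imp_le)
    with xp p have "x \<in> {6, 7, 8}" by auto
    with \<open>x dvd 8\<close> have "x = 8" by auto
    then show ?thesis using xp M3 by simp
  qed
qed

text \<open>The size bound is too weak here, since \<open>x * p ^ 2\<close> may dominate. Instead
  \<open>x\<close> is factored out of \<open>M\<close>, and the equation is read modulo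
  \<open>q = p + 1\<close>, where \<open>p\<close> is -1. The pair \<open>(3, 10)\<close> arises for
  \<open>c = 2\<close>; 10 is not a power of two, so it is discarded in the final theorem.\<close>

lemma omitted_equation_cofactor_prime_square:
  fixes p M x :: int
  assumes p: "p \<ge> 3" and x: "2 * x dvd M" "x > 0"
    and eq: "M * (p + 1) = p ^ c + x * p ^ 2 + p ^ 2 + p + 1" and c: "c \<le> 2"
  shows "(p, M) \<in> {(3, 8), (3, 10)}"
proof -
  obtain m where m: "M = x * m" using x(1) by (metis dvd_mult_right dvdE)
  define q where "q = p + 1"
  \<comment> \<open>As \<open>p ^ 2 = q ^ 2 - 2 * q + 1\<close>, this shift turns
    \<open>m * q - p ^ 2\<close> into \<open>s * q - 1\<close>.\<close>
  define s where "s = m - q + 2"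
  have pq: "p = q - 1" and q: "q \<ge> 4" using p by (simp_all add: q_def)
  have key: "x * (s * q - 1) = p ^ c + p ^ 2 + p + 1"
    using eq unfolding m s_def q_def by (simp add: algebra_simps power2_eq_square)
  moreover have "p ^ c + p ^ 2 + p + 1 > 0" using p by (simp add: add_nonneg_pos)
  ultimately have "x * (s * q - 1) > 0" by metis
  then have "s * q > 1" using x(2) by (simp add: zero_less_mult_iff)
  then have s: "s \<ge> 1" using q by (smt (verit) mult_nonpos_nonneg)
  have Mx: "M = x * (s + q - 2)" using m by (simp add: s_def)
  have pow: "p ^ 2 = q * q - 2 * q + 1" by (simp add: pq power2_eq_square algebra_simps)
  consider "c = 0" | "c = 1" | "c = 2" using c by linarith
  then show ?thesis
  proof cases
    case 1
    \<comment> \<open>Modulo \<open>q\<close> the equation \<open>key\<close> reads -x = 2.\<close>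
    have "x + 2 = q * (x * s - q + 1)"
      using key 1 unfolding pow by (simp add: pq algebra_simps)
    then obtain u where u: "x = u * q - 2" by (metis add_diff_cancel_right' mult.commute)
    have "u * q > 0" using u x(2) by simp
    then have "u \<ge> 1" using q by (smt (verit) mult_nonpos_nonneg)
    have "q * ((u * s - 1) * q) = q * (u + 2 * s - 1)"
      using key 1 unfolding pow u by (simp add: pq algebra_simps)
    then have e: "(u * s - 1) * q = u + 2 * s - 1" using q by simp
    then have "u * s \<ge> 2" using \<open>u \<ge> 1\<close> s q
      by (smt (verit) mult_nonneg_nonneg mult_nonpos_nonneg)
    then have "(u * s - 1) * 4 \<le> u + 2 * s - 1"
      using e q by (metis diff_ge_0_iff_ge dual_order.trans mult_left_mono one_le_numeral)
    then have le: "4 * (u * s) \<le> u + 2 * s + 3" by simp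
    \<comment> \<open>Shifting to nonnegative variables makes the product term
      \<open>u' * s'\<close> droppable, leaving a linear bound.\<close>
    obtain u' s' where us: "u = u' + 1" "s = s' + 1" "u' \<ge> 0" "s' \<ge> 0"
      using \<open>u \<ge> 1\<close> s by (metis add.commute add_diff_cancel_left' diff_add_cancel diff_ge_0_iff_ge)
    have "u' * s' \<ge> 0" using us by simp
    then have "3 * u' + 2 * s' \<le> 2"
      using le unfolding us(1,2) distrib_left distrib_right by linarith
    then have "u' = 0" "s' \<le> 1" using us(3,4) by linarith+
    then have "u = 1" "s = 2" using \<open>u * s \<ge> 2\<close> us by auto
    then have "q = 4" using e by simp
    then show ?thesis using Mx u \<open>u = 1\<close> \<open>s = 2\<close> pq by simp
  next
    case 2
    have "x = q * (x * s - q)"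
      using key 2 unfolding pow by (simp add: pq algebra_simps)
    then obtain u where u: "x = u * q" by (metis mult.commute)
    have "u * q > 0" using u x(2) by simp
    then have "u \<ge> 1" using q by (smt (verit) mult_nonpos_nonneg)
    have "q * (u * (s * q - 1)) = q * q"
      using key 2 unfolding pow u by (simp add: pq algebra_simps)
    then have e: "u * (s * q - 1) = q" using q by simp
    \<comment> \<open>A positive integer dividing its successor is 1, but \<open>s * q - 1\<close>
      is at least 3.\<close>
    then have "(s * q - 1) dvd s * q" by (metis dvd_mult dvd_triv_right)
    then have "(s * q - 1) dvd s * q - (s * q - 1)" by (rule dvd_diff[OF _ dvd_refl])
    then have "(s * q - 1) dvd 1" by simp
    then have "s * q - 1 \<le> 1" by (rule zdvd_imp_le) simp
    moreover have "1 * q \<le> s * q" using s q by (intro mult_right_mono) auto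
    ultimately show ?thesis using q by simp
  next
    case 3
    have "x + 2 = q * (x * s - 2 * q + 3)"
      using key unfolding 3 pow by (simp add: pq algebra_simps)
    then obtain u where u: "x = u * q - 2" by (metis add_diff_cancel_right' mult.commute)
    have "u * q > 0" using u x(2) by simp
    then have "u \<ge> 1" using q by (smt (verit) mult_nonpos_nonneg)
    have "q * ((u * s - 2) * q) = q * (u + 2 * s - 3)"
      using key unfolding 3 pow u by (simp add: pq algebra_simps)
    then have e: "(u * s - 2) * q = u + 2 * s - 3" using q by simp
    obtain u' s' where us: "u = u' + 1" "s = s' + 1" "u' \<ge> 0" "s' \<ge> 0"
      using \<open>u \<ge> 1\<close> s by (metis add.commute add_diff_cancel_left' diff_add_cancel diff_ge_0_iff_ge)
    have us0: "u' * s' \<ge> 0" using us by simp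
    have "u * s \<ge> 2"
    proof (rule ccontr)
      assume "\<not> u * s \<ge> 2"
      then have "u' = 0" "s' = 0" using us0 us(3,4) unfolding us(1,2) distrib_left distrib_right by linarith+
      then show False using e us q by simp
    qed
    then have "(u * s - 2) * 4 \<le> u + 2 * s - 3"
      using e q by (metis diff_ge_0_iff_ge mult_left_mono)
    then have "4 * (u * s) \<le> u + 2 * s + 5" by simp
    then have "3 * u' + 2 * s' \<le> 4"
      using us0 unfolding us(1,2) distrib_left distrib_right by linarith
    \<comment> \<open>Of these four candidates only \<open>u = 1\<close>, \<open>s = 3\<close>
      satisfies \<open>e\<close>.\<close>
    then have "u' = 0 \<and> s' \<in> {0, 1, 2} \<or> u' = 1 \<and> s' = 0" using us(3,4) by auto
    then have "u = 1" "s = 3" "q = 4" using e us q by auto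
    then show ?thesis using Mx u pq by simp
  qed
qed

section \<open>Reduction to the integer equation and the classification\<close>

lemma dvd_two_power_times_square:
  fixes d k p :: nat
  assumes "prime p" "d dvd 2 ^ k * p ^ 2"
  obtains x b where "d = x * p ^ b" "x dvd 2 ^ k" "b \<le> 2"
  using assms division_decomp[OF assms(2)] divides_primepow_nat[OF assms(1)] by metis

text \<open>An odd divisor has no factor 2, so \<open>d\<close> is a pure power of \<open>p\<close>,
  and the exponent of \<open>p\<close> in \<open>e\<close> selects one of the three equations. They
  are solved over \<open>int\<close> because \<open>s\<close> and \<open>t\<close> are differences
  of a priori unknown sign.\<close>

lemma two_power_times_square_eqs:
  fixes k p d e :: nat
  assumes "prime p" "odd p" "d dvd 2 ^ k * p ^ 2" "e dvd 2 ^ k * p ^ 2" "odd d"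
    and sum: "d + e + p ^ 2 + p + 1 = 2 ^ (k + 1) * (p + 1)"
  shows "(p, 2 ^ (k + 1)) \<in> {(3, 4), (3, 6), (5, 16), (3, 8), (3, 10 :: nat)}"
proof -
  have p3: "int p \<ge> 3" "odd (int p)"
    using prime_ge_2_nat[OF assms(1)] \<open>odd p\<close> by (cases "p = 2"; simp)+
  obtain y c where y: "d = y * p ^ c" "y dvd 2 ^ k" and c: "c \<le> 2"
    using assms(1,3) by (rule dvd_two_power_times_square)
  have "y = 1"
    using y \<open>odd d\<close> by (metis coprime_common_divisor_nat coprime_power_right_iff
      coprime_right_2_iff_odd dvd_refl even_mult_iff)
  obtain x b where x: "e = x * p ^ b" "x dvd 2 ^ k" and b: "b \<le> 2"
    using assms(1,4) by (rule dvd_two_power_times_square)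
  define M :: int where "M = 2 ^ (k + 1)"
  have "2 * x dvd 2 ^ (k + 1)" using x(2) by simp
  then have xM: "2 * int x dvd M"
    unfolding M_def by (metis of_nat_dvd_iff of_nat_mult of_nat_numeral of_nat_power)
  have x0: "int x > 0" using x(2) by (auto intro: Nat.gr0I)
  have "int (2 ^ (k + 1) * (p + 1)) = int (d + e + p ^ 2 + p + 1)" using sum by simp
  then have eq: "M * (int p + 1) = int p ^ c + int x * int p ^ b + int p ^ 2 + int p + 1"
    unfolding x y \<open>y = 1\<close> by (simp add: M_def algebra_simps)
  have "(int p, M) \<in> {(3, 4), (3, 6), (5, 16), (3, 8), (3, 10)}"
  proof -
    consider "b = 0" | "b = 1" | "b = 2" using b by linarith
    then show ?thesis
    proof cases
      case 1
      then show ?thesis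
        using omitted_equation_cofactor_one[OF p3(1) xM x0 _ c] eq by auto
    next
      case 2
      then show ?thesis
        using omitted_equation_cofactor_prime[OF p3 xM x0 _ c] eq by auto
    next
      case 3
      then show ?thesis
        using omitted_equation_cofactor_prime_square[OF p3(1) xM x0 _ c] eq by auto
    qed
  qed
  moreover have "M = int (2 ^ (k + 1))" by (simp add: M_def)
  ultimately show ?thesis by (simp only: insert_iff prod.inject empty_iff) linarith
qed

theorem theorem2:
  fixes n d1 d2 k p :: nat
  assumes "two_near_perfect n"
    and "omitted_divisors n d1 d2"
    and "prime p"
    and "n = 2 ^ k * p ^ 2"
  shows "n \<in> {18, 36, 200}"
proof (cases "p = 2")
  case True
  then have "n = 2 ^ (k + 2)" using assms(4) by (simp add: power_add)
  \<comment> \<open>A power of two is deficient: its divisor sum is below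
    \<open>2 * n\<close>.\<close>
  then have "divisor_sigma n + 1 = 2 * n"
    using divisor_sigma_two_power[of "k + 2"] by simp
  then show ?thesis using assms(2) by (simp add: omitted_divisors_def)
next
  case False
  then have "odd p" using assms(3) primes_dvd_imp_eq two_is_prime_nat by blast
  have d: "d1 dvd 2 ^ k * p ^ 2" "d2 dvd 2 ^ k * p ^ 2"
    and sigma: "divisor_sigma n = 2 * n + d1 + d2"
    using assms(2,4) by (simp_all add: omitted_divisors_def)
  have "coprime (2 ^ k) (p ^ 2)" using \<open>odd p\<close> by simp
  then have "divisor_sigma n = divisor_sigma (2 ^ k) * divisor_sigma (p ^ 2)"
    using assms(3,4) by (simp add: divisor_sigma_coprime_mult prime_gt_0_nat)
  also have "divisor_sigma (p ^ 2) = p ^ 2 + p + 1"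
    using assms(3) unfolding divisor_sigma_prime_power[OF assms(3)]
    by (simp add: numeral_2_eq_2)
  finally have "divisor_sigma n + (p ^ 2 + p + 1) = (divisor_sigma (2 ^ k) + 1) * (p ^ 2 + p + 1)"
    by simp
  then have "2 * n + d1 + d2 + (p ^ 2 + p + 1) = 2 ^ (k + 1) * (p ^ 2 + p + 1)"
    unfolding divisor_sigma_two_power sigma .
  then have sum: "d1 + d2 + p ^ 2 + p + 1 = 2 ^ (k + 1) * (p + 1)"
    unfolding assms(4) by (simp add: algebra_simps)
  \<comment> \<open>For odd \<open>p\<close> the part \<open>p ^ 2 + p + 1\<close> is odd, so
    \<open>d1 + d2\<close> is odd.\<close>
  have "even (d1 + d2 + p ^ 2 + p + 1)" unfolding sum by simp
  then have "odd d1 \<or> odd d2" using \<open>odd p\<close> by auto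
  then have "(p, 2 ^ (k + 1)) \<in> {(3, 4), (3, 6), (5, 16), (3, 8), (3, 10 :: nat)}"
  proof
    assume "odd d1"
    then show ?thesis
      using two_power_times_square_eqs[OF assms(3) \<open>odd p\<close> d] sum by simp
  next
    assume "odd d2"
    then show ?thesis
      using two_power_times_square_eqs[OF assms(3) \<open>odd p\<close> d(2,1)] sum by (simp add: add.commute)
  qed
  \<comment> \<open>This rules out \<open>2 ^ (k + 1)\<close> being 6 or 10; the other pairs give
    18, 200 and 36.\<close>
  moreover have "2 ^ k \<noteq> (r :: nat)" if "r \<in> {3, 5}" for r
    using that by (cases k) (auto, presburger+)
  ultimately show ?thesis unfolding assms(4) by auto
qed

end
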